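(* Both of the following hold. (a) There exist a (nonzero) absolutely decaying measure $\mu$ on $\mathbb{R}$ and a decreasing function $\psi:\mathbb{N}\to(0,+\infty)$ such that neither the set of $\psi$-approximable numbers nor its complement has $\mu$-measure $0$. (b) There exist a (nonzero) absolutely decaying measure $\mu$ on $\mathbb{R}$ and a decreasing function $\psi:\mathbb{N}\to(0,+\infty)$ for which the equivalence $$\mu\text{-almost every point is }\psi\text{-approximable}\iff\sum_{q=1}^\infty q\,\psi(q)=\infty$$ fails.
   Context: All measures are Borel and locally finite. For $\alpha>0$, a measure $\mu$ on $\mathbb{R}$ is absolutely $\alpha$-decaying if there exists $C>0$ such that $\mu(B(x,\varepsilon r))\le C\varepsilon^\alpha\mu(B(x,r))$ for all $x\in\mathbb{R}$, all $0<r\le1$ and all $0<\varepsilon\le1$; it is absolutely decaying if it is absolutely $\alpha$-decaying for some $\alpha>0$. An irrational $x\in\mathbb{R}$ is $\psi$-approximable if there exist infinitely many rationals $p/q$ (in lowest terms, $q\ge1$) with $|x-p/q|\le\psi(q)$. *)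

theory Defs
  imports "HOL-Analysis.Analysis"
begin

definition borel_locally_finite :: "real measure \<Rightarrow> bool" where
  "borel_locally_finite \<mu> \<longleftrightarrow>
     sets \<mu> = sets borel \<and> (\<forall>x. \<exists>r>0. emeasure \<mu> (ball x r) < \<infinity>)"

text \<open>Balls are open here. Using closed balls instead only changes the constant \<open>C\<close>.\<close>

definition abs_alpha_decaying :: "real \<Rightarrow> real measure \<Rightarrow> bool" where
  "abs_alpha_decaying \<alpha> \<mu> \<longleftrightarrow> borel_locally_finite \<mu> \<and>
     (\<exists>C>0. \<forall>x r \<epsilon>. 0 < r \<and> r \<le> 1 \<and> 0 < \<epsilon> \<and> \<epsilon> \<le> 1 \<longrightarrow>
        emeasure \<mu> (ball x (\<epsilon> * r)) \<le> ennreal (C * \<epsilon> powr \<alpha>) * emeasure \<mu> (ball x r))"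

definition absolutely_decaying :: "real measure \<Rightarrow> bool" where
  "absolutely_decaying \<mu> \<longleftrightarrow> (\<exists>\<alpha>>0. abs_alpha_decaying \<alpha> \<mu>)"

text \<open>A rational is represented by its unique pair \<open>(p, q)\<close> in lowest terms with \<open>q \<ge> 1\<close>.\<close>

definition psi_approximable :: "(nat \<Rightarrow> real) \<Rightarrow> real \<Rightarrow> bool" where
  "psi_approximable \<psi> x \<longleftrightarrow> x \<notin> \<rat> \<and>
     infinite {(p :: int, q :: nat). q \<ge> 1 \<and> coprime p (int q) \<and>
                 \<bar>x - of_int p / of_nat q\<bar> \<le> \<psi> q}"

end

theory Submission
  imports Defs
begin

text \<open>
  Take \<open>\<psi> q = 1 / (200 (q + 1)\<^sup>2)\<close>, so that \<open>q \<psi>(q)\<close> is comparable to \<open>1 / q\<close>.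
  A Cantor set of badly approximable numbers, all of whose points keep distance
  at least \<open>1 / (100 q\<^sup>2)\<close> from every \<open>p / q\<close>, carries an absolutely decaying probability
  measure \<open>\<nu>\<close>: an interval of length \<open>5\<^bsup>-n\<^esup>\<close> is close to at most one fraction with
  \<open>2 q\<^sup>2 < 5\<^sup>n\<close>, and this fraction spoils at most one of its first, third and fifth subintervals
  of length \<open>5\<^bsup>-n-1\<^esup>\<close>. The measure \<open>\<nu>\<close> gives (b). For (a), add Lebesgue measure, for
  which the approximable points are not null: by Dirichlet's theorem there are at least
  \<open>N\<^sup>2 / 32\<close> reduced fractions in the unit interval with denominator in \<open>(N / 8, N]\<close>, and
  the intervals of radius \<open>c / N\<^sup>2\<close> around them are disjoint and have total length at least \<open>c / 16\<close>.
\<close>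

section \<open>Measures on Cantor sets\<close>

lemma power_of_5_between:
  fixes y :: real
  assumes "0 < y" "y \<le> 1"
  obtains n where "1 / 5 ^ n \<le> y" "y < 5 / 5 ^ n"
proof -
  define n where "n = (LEAST n. 1 / 5 ^ n \<le> y)"
  have "\<exists>n. 1 / 5 ^ n \<le> y"
    using real_arch_pow_inv[OF assms(1), of "1 / 5"] by (auto simp: power_one_over intro: less_imp_le)
  then have n: "1 / 5 ^ n \<le> y" unfolding n_def by (rule LeastI_ex)
  have "y < 5 / 5 ^ n"
  proof (cases n)
    case 0
    then show ?thesis using assms by simp
  next
    case (Suc k)
    then have "\<not> 1 / 5 ^ k \<le> y" unfolding n_def by (intro not_less_Least) simp
    then show ?thesis using Suc by simp
  qed
  with n show ?thesis by (rule that)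
qed

text \<open>
  \<open>a n k\<close> is the left endpoint of the \<open>k\<close>-th interval of level \<open>n\<close>, which has length \<open>5\<^bsup>-n\<^esup>\<close>
  and contains the intervals \<open>2 k\<close> and \<open>2 k + 1\<close> of level \<open>n + 1\<close>. The Cantor measure is the image of
  Lebesgue measure on \<open>[0, 1)\<close> under the map that reads the branches off the binary digits.
\<close>

locale cantor_tree =
  fixes a :: "nat \<Rightarrow> int \<Rightarrow> real"
  assumes left_mono: "a n (k div 2) \<le> a (Suc n) k"
    and right_mono: "a (Suc n) k + 1 / 5 ^ Suc n \<le> a n (k div 2) + 1 / 5 ^ n"
    and gap: "a (Suc n) (2 * k) + 2 / 5 ^ Suc n \<le> a (Suc n) (2 * k + 1)"
begin

definition code :: "nat \<Rightarrow> real \<Rightarrow> int" where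
  "code n t = \<lfloor>2 ^ n * t\<rfloor>"

definition limit_point :: "real \<Rightarrow> real" where
  "limit_point t = (SUP n. a n (code n t))"

definition cantor_measure :: "real measure" where
  "cantor_measure = distr (restrict_space lborel {0..<1}) borel limit_point"

text \<open>Halving drops the last binary digit, so \<open>code n t\<close> is the parent of
  \<open>code (Suc n) t\<close> in the tree.\<close>

lemma code_Suc: "code (Suc n) t div 2 = code n t"
proof -
  have "code n t = \<lfloor>(2 ^ Suc n * t) / real_of_int 2\<rfloor>"
    by (simp add: code_def)
  also have "\<dots> = code (Suc n) t div 2"
    unfolding code_def by (rule floor_divide_real_eq_div) simp
  finally show ?thesis by simp
qed

lemma left_incseq: "incseq (\<lambda>n. a n (code n t))"
  using left_mono[of _ "code (Suc _) t"] by (intro incseq_SucI) (simp add: code_Suc)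

lemma right_decseq: "decseq (\<lambda>n. a n (code n t) + 1 / 5 ^ n)"
  using right_mono[of _ "code (Suc _) t"] by (intro decseq_SucI) (simp add: code_Suc)

lemma left_le_right: "a m (code m t) \<le> a n (code n t) + 1 / 5 ^ n"
proof -
  let ?k = "max m n"
  have "a m (code m t) \<le> a ?k (code ?k t)"
    using incseqD[OF left_incseq, of m ?k] by simp
  also have "\<dots> \<le> a ?k (code ?k t) + 1 / 5 ^ ?k" by simp
  also have "\<dots> \<le> a n (code n t) + 1 / 5 ^ n"
    using decseqD[OF right_decseq, of n ?k] by simp
  finally show ?thesis .
qed

lemma bdd_above_left: "bdd_above (range (\<lambda>n. a n (code n t)))"
  using left_le_right[of _ t 0] by (intro bdd_aboveI2)

lemma limit_point_bounds: "limit_point t \<in> {a n (code n t)..a n (code n t) + 1 / 5 ^ n}"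
  unfolding limit_point_def atLeastAtMost_iff
  using bdd_above_left left_le_right by (auto intro: cSUP_upper cSUP_least)

lemma limit_point_measurable [measurable]: "limit_point \<in> borel_measurable borel"
proof (rule borel_measurable_LIMSEQ_real)
  show "(\<lambda>n. a n (code n t)) \<longlonglongrightarrow> limit_point t" for t
    unfolding limit_point_def using bdd_above_left left_incseq by (rule LIMSEQ_incseq_SUP)
  show "(\<lambda>t. a n (code n t)) \<in> borel_measurable borel" for n
    unfolding code_def by measurable
qed

text \<open>At the first level where the codes differ they are siblings, and \<open>gap\<close>
  leaves one interval length of that level between siblings.\<close>

lemma limit_point_separated:
  assumes "s \<in> {0..<1}" "t \<in> {0..<1}" "code n s \<noteq> code n t"
  shows "1 / 5 ^ n \<le> \<bar>limit_point s - limit_point t\<bar>"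
  using assms(3)
proof (induction n)
  case 0
  with assms(1,2) have "code 0 s = 0" "code 0 t = 0"
    by (auto simp: code_def floor_eq_iff)
  with 0 show ?case by simp
next
  case (Suc n)
  show ?case
  proof (cases "code n s = code n t")
    case False
    have "1 / 5 ^ Suc n \<le> (1 / 5 ^ n :: real)" by (simp add: field_simps)
    with Suc.IH[OF False] show ?thesis by linarith
  next
    case True
    have *: "1 / 5 ^ Suc n \<le> limit_point y - limit_point x"
      if "code (Suc n) x = 2 * k" "code (Suc n) y = 2 * k + 1" for x y k
      using limit_point_bounds[of x "Suc n"] limit_point_bounds[of y "Suc n"] gap[of n k] that
      by auto
    define k where "k = code n s"
    have "code (Suc n) s div 2 = k" "code (Suc n) t div 2 = k"
      using True by (simp_all add: code_Suc k_def)
    then have "code (Suc n) s = 2 * k \<and> code (Suc n) t = 2 * k + 1 \<or>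
        code (Suc n) s = 2 * k + 1 \<and> code (Suc n) t = 2 * k"
      using Suc.prems by presburger
    then show ?thesis using *[of s k t] *[of t k s] by linarith
  qed
qed

section \<open>Masses of branches and of balls\<close>

lemma code_vimage: "{s. code n s = k} = {k / 2 ^ n..<(k + 1) / 2 ^ n}"
  by (auto simp: code_def floor_eq_iff field_simps)

lemma emeasure_code: "emeasure lborel {s. code n s = k} = ennreal (1 / 2 ^ n)"
proof -
  have "(k + 1) / 2 ^ n - k / 2 ^ n = (1 / 2 ^ n :: real)"
    by (simp add: add_divide_distrib)
  moreover have "k / 2 ^ n \<le> (k + 1) / (2 ^ n :: real)"
    by (simp add: divide_right_mono)
  ultimately show ?thesis by (simp add: code_vimage)
qed

text \<open>A dyadic interval that meets \<open>{0..<1}\<close> lies inside it, so the restriction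
  to \<open>{0..<1}\<close> takes no mass from its branch.\<close>

lemma code_subset:
  assumes "t \<in> {0..<1}" "code n s = code n t"
  shows "s \<in> {0..<1}"
proof -
  have "code n t \<ge> 0" using assms by (simp add: code_def)
  moreover have "code n t < 2 ^ n"
    using assms(1) by (simp add: code_def floor_less_iff)
  ultimately have "0 \<le> \<lfloor>2 ^ n * s\<rfloor>" "\<lfloor>2 ^ n * s\<rfloor> < 2 ^ n"
    using assms(2) by (auto simp: code_def)
  then show ?thesis
    by (simp add: floor_less_iff zero_le_mult_iff not_le[of "2 ^ n" 0, THEN iffD2])
qed

lemma sets_cantor_measure: "sets cantor_measure = sets borel"
  by (simp add: cantor_measure_def)

lemma emeasure_cantor_measure:
  assumes "A \<in> sets borel"
  shows "emeasure cantor_measure A = emeasure lborel {t \<in> {0..<1}. limit_point t \<in> A}"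
proof -
  have "limit_point \<in> borel_measurable (restrict_space lborel {0..<1})"
    by (rule measurable_restrict_space1) simp
  then have "emeasure cantor_measure A
      = emeasure (restrict_space lborel {0..<1}) (limit_point -` A \<inter> {0..<1})"
    using assms by (simp add: cantor_measure_def emeasure_distr space_restrict_space)
  also have "\<dots> = emeasure lborel (limit_point -` A \<inter> {0..<1})"
    by (rule emeasure_restrict_space) auto
  also have "limit_point -` A \<inter> {0..<1} = {t \<in> {0..<1}. limit_point t \<in> A}" by auto
  finally show ?thesis .
qed

lemma emeasure_cantor_measure_UNIV: "emeasure cantor_measure UNIV = 1"
proof -
  have "{t::real. 0 \<le> t \<and> t < 1} = {0..<1}" by auto
  then show ?thesis by (simp add: emeasure_cantor_measure)
qed

text \<open>Points of different branches of level \<open>m\<close> are at least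
  \<open>1 / 5 ^ m\<close> apart, so the ball meets at most one branch, of mass
  \<open>1 / 2 ^ m\<close>.\<close>

lemma emeasure_ball_le:
  assumes "2 * r \<le> 1 / 5 ^ m"
  shows "emeasure cantor_measure (ball x r) \<le> ennreal (1 / 2 ^ m)"
proof (cases "\<exists>t\<in>{0..<1}. limit_point t \<in> ball x r")
  case True
  then obtain t where t: "t \<in> {0..<1}" "limit_point t \<in> ball x r" by blast
  have "{s \<in> {0..<1}. limit_point s \<in> ball x r} \<subseteq> {s. code m s = code m t}"
  proof clarify
    fix s assume s: "s \<in> {0..<1}" "limit_point s \<in> ball x r"
    have "\<bar>limit_point s - limit_point t\<bar> < 2 * r"
      using s t by (auto simp: dist_real_def)
    then show "code m s = code m t"
      using limit_point_separated[OF s(1) t(1), of m] assms by linarith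
  qed
  then have "emeasure lborel {s \<in> {0..<1}. limit_point s \<in> ball x r}
      \<le> emeasure lborel {s. code m s = code m t}"
    by (rule emeasure_mono) (simp add: code_vimage)
  then show ?thesis by (simp add: emeasure_cantor_measure emeasure_code)
next
  case False
  then have "{s \<in> {0..<1}. limit_point s \<in> ball x r} = {}" by blast
  then have "emeasure cantor_measure (ball x r) = 0"
    by (subst emeasure_cantor_measure) (simp, simp only: emeasure_empty)
  then show ?thesis by simp
qed

text \<open>A ball of nonzero mass contains a limit point, and the whole branch of level
  \<open>n\<close> through it stays within \<open>1 / 5 ^ n\<close> of it.\<close>

lemma emeasure_ball_ge:
  assumes "r' + 1 / 5 ^ n \<le> r" "emeasure cantor_measure (ball x r') \<noteq> 0"
  shows "ennreal (1 / 2 ^ n) \<le> emeasure cantor_measure (ball x r)"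
proof -
  have "{t \<in> {0..<1}. limit_point t \<in> ball x r'} \<noteq> {}"
    using assms(2) emeasure_cantor_measure[of "ball x r'"] by (metis emeasure_empty borel_open open_ball)
  then obtain t where t: "t \<in> {0..<1}" "limit_point t \<in> ball x r'" by blast
  have "{s. code n s = code n t} \<subseteq> {s \<in> {0..<1}. limit_point s \<in> ball x r}"
  proof clarify
    fix s assume s: "code n s = code n t"
    have "\<bar>limit_point s - limit_point t\<bar> \<le> 1 / 5 ^ n"
      using limit_point_bounds[of s n] limit_point_bounds[of t n] s by auto
    then show "s \<in> {0..<1} \<and> limit_point s \<in> ball x r"
      using code_subset[OF t(1) s] t(2) assms(1) by (auto simp: dist_real_def)
  qed
  then have "emeasure lborel {s. code n s = code n t}
      \<le> emeasure lborel {s \<in> {0..<1}. limit_point s \<in> ball x r}"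
    by (rule emeasure_mono) simp
  then show ?thesis by (simp add: emeasure_cantor_measure emeasure_code)
qed

text \<open>The exponent satisfies \<open>5 powr \<alpha> = 2\<close>, which turns lengths
  \<open>1 / 5 ^ n\<close> into masses \<open>1 / 2 ^ n\<close>.\<close>

lemma abs_alpha_decaying_cantor_measure: "abs_alpha_decaying (log 5 2) cantor_measure"
proof -
  define \<alpha> :: real where "\<alpha> = log 5 2"
  have \<alpha>: "\<alpha> > 0" by (simp add: \<alpha>_def)
  have "(5::real) powr \<alpha> = 2" by (simp add: \<alpha>_def)
  then have two_pow: "(1 / 5 ^ n) powr \<alpha> = 1 / 2 ^ n" for n
    by (simp add: powr_divide powr_realpow[symmetric] powr_powr mult.commute[of _ \<alpha>])
       (simp add: powr_powr[symmetric])
  have "emeasure cantor_measure (ball x (\<epsilon> * r))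
      \<le> ennreal (100 powr \<alpha> * \<epsilon> powr \<alpha>) * emeasure cantor_measure (ball x r)"
    if r: "0 < r" "r \<le> 1" and \<epsilon>: "0 < \<epsilon>" "\<epsilon> \<le> 1" for x r \<epsilon>
  \<comment> \<open>For \<open>\<epsilon> < 1 / 2\<close> the larger radius exceeds the smaller by
    at least \<open>r / 2\<close>, room for a full branch of level \<open>n\<close>. For other
    \<open>\<epsilon>\<close> monotonicity suffices.\<close>
  proof (cases "\<epsilon> < 1 / 2 \<and> emeasure cantor_measure (ball x (\<epsilon> * r)) \<noteq> 0")
    case True
    have "\<epsilon> * r \<le> 1 / 2 * r" using True r by (intro mult_right_mono) auto
    then have er: "\<epsilon> * r \<le> r / 2" by simp
    have "\<epsilon> * r < 1 / 2 * 1"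
      by (rule less_le_trans[of _ "1 / 2 * r"]) (use True r in auto)
    then have er1: "2 * (\<epsilon> * r) < 1" by simp
    have er0: "0 < 2 * (\<epsilon> * r)" using r \<epsilon> by simp
    obtain n where n: "1 / 5 ^ n \<le> r / 2" "r / 2 < 5 / 5 ^ n"
      using power_of_5_between[of "r / 2"] r by auto
    obtain m' where m': "1 / 5 ^ m' \<le> 2 * (\<epsilon> * r)" "2 * (\<epsilon> * r) < 5 / 5 ^ m'"
      using power_of_5_between[OF er0] er1 by auto
    \<comment> \<open>\<open>m' = 0\<close> would give \<open>1 \<le> 2 * (\<epsilon> * r)\<close>.
      For the predecessor \<open>m\<close> the upper bound reads
      \<open>2 * (\<epsilon> * r) < 1 / 5 ^ m\<close>, as \<open>emeasure_ball_le\<close>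
      asks.\<close>
    then obtain m where m: "m' = Suc m" using er1 by (cases m') auto
    \<comment> \<open>The constant 100 is a factor 10 from rounding \<open>\<epsilon> * r\<close> to
      level \<open>m\<close> times a factor 10 from rounding \<open>r\<close> to level
      \<open>n\<close>.\<close>
    have "1 / 5 ^ m \<le> 10 * (\<epsilon> * r)" using m'(1) unfolding m by (simp add: field_simps)
    also have "\<dots> \<le> 10 * (\<epsilon> * (10 / 5 ^ n))"
      using n(2) \<epsilon> by (intro mult_left_mono) auto
    finally have "1 / 5 ^ m \<le> 100 * \<epsilon> * (1 / 5 ^ n)" by simp
    then have "(1 / 5 ^ m) powr \<alpha> \<le> (100 * \<epsilon> * (1 / 5 ^ n)) powr \<alpha>"
      using \<alpha> by (intro powr_mono2) auto
    also have "\<dots> = 100 powr \<alpha> * \<epsilon> powr \<alpha> * (1 / 5 ^ n) powr \<alpha>"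
      using \<epsilon> by (simp only: powr_mult zero_le_mult_iff)
    finally have mn: "1 / 2 ^ m \<le> 100 powr \<alpha> * \<epsilon> powr \<alpha> * (1 / 2 ^ n)"
      by (simp add: two_pow)
    have "emeasure cantor_measure (ball x (\<epsilon> * r)) \<le> ennreal (1 / 2 ^ m)"
      using m'(2) m by (intro emeasure_ball_le) simp
    also have "\<dots> \<le> ennreal (100 powr \<alpha> * \<epsilon> powr \<alpha>) * ennreal (1 / 2 ^ n)"
      using mn by (subst ennreal_mult''[symmetric]) (auto intro: ennreal_leI)
    also have "\<dots> \<le> ennreal (100 powr \<alpha> * \<epsilon> powr \<alpha>) * emeasure cantor_measure (ball x r)"
      using n(1) er True by (intro mult_left_mono emeasure_ball_ge[of "\<epsilon> * r"]) auto
    finally show ?thesis .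
  next
    case False
    show ?thesis
    proof (cases "\<epsilon> < 1 / 2")
      case True
      with False show ?thesis by simp
    next
      case False
      have "1 \<le> (100 * \<epsilon>) powr \<alpha>" using False \<alpha> by (intro ge_one_powr_ge_zero) auto
      then have 1: "1 \<le> ennreal (100 powr \<alpha> * \<epsilon> powr \<alpha>)"
        using \<epsilon> by (simp add: powr_mult)
      have "emeasure cantor_measure (ball x (\<epsilon> * r)) \<le> emeasure cantor_measure (ball x r)"
        using r \<epsilon> by (intro emeasure_mono subset_ball) (auto simp: sets_cantor_measure)
      also have "\<dots> \<le> ennreal (100 powr \<alpha> * \<epsilon> powr \<alpha>) * emeasure cantor_measure (ball x r)"
        using mult_right_mono[OF 1] by simp
      finally show ?thesis .
    qed
  qed
  moreover have "emeasure cantor_measure (ball x 1) < \<infinity>" for x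
  proof -
    have "emeasure cantor_measure (ball x 1) \<le> emeasure cantor_measure UNIV"
      by (intro emeasure_mono) (simp_all add: sets_cantor_measure)
    then show ?thesis by (simp add: emeasure_cantor_measure_UNIV order_le_less_trans)
  qed
  then have "borel_locally_finite cantor_measure"
    unfolding borel_locally_finite_def using sets_cantor_measure zero_less_one by blast
  moreover have "(100::real) powr \<alpha> > 0" by simp
  ultimately show ?thesis
    unfolding abs_alpha_decaying_def \<alpha>_def by blast
qed

end

section \<open>Badly approximable numbers\<close>

text \<open>Distinct fractions with these denominators differ by at least
  \<open>1 / (q * q')\<close>, which exceeds \<open>2 / 5 ^ n\<close>, while both are close to one
  interval of length \<open>1 / 5 ^ n\<close>.\<close>

lemma at_most_one_fraction_near:
  fixes a :: real
  assumes "\<bar>y - real_of_int p / real q\<bar> < 1 / (2 * 5 ^ Suc n)"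
    and "\<bar>y' - real_of_int p' / real q'\<bar> < 1 / (2 * 5 ^ Suc n)"
    and "y \<in> {a..a + 1 / 5 ^ n}" "y' \<in> {a..a + 1 / 5 ^ n}"
    and "0 < q" "0 < q'" "2 * (real q)\<^sup>2 < 5 ^ n" "2 * (real q')\<^sup>2 < 5 ^ n"
  shows "real_of_int p / real q = real_of_int p' / real q'"
proof (rule ccontr)
  assume neq: "real_of_int p / real q \<noteq> real_of_int p' / real q'"
  define d where "d = p * int q' - p' * int q"
  have eq: "real_of_int p / real q - real_of_int p' / real q' = real_of_int d / (real q * real q')"
    using assms(5,6) by (simp add: d_def field_simps)
  then have "d \<noteq> 0" using neq by auto
  then have "1 \<le> \<bar>real_of_int d\<bar>" by linarith
  have "(2 * (real q * real q'))\<^sup>2 = (2 * (real q)\<^sup>2) * (2 * (real q')\<^sup>2)"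
    by (simp add: power2_eq_square)
  also have "\<dots> < 5 ^ n * 5 ^ n" using assms(5-8) by (intro mult_strict_mono) auto
  finally have "2 * (real q * real q') < 5 ^ n"
    unfolding power2_eq_square[of "5 ^ n", symmetric] by (rule power2_less_imp_less) simp
  then have "2 / 5 ^ n < 1 / (real q * real q')"
    using assms(5,6) by (simp add: field_simps)
  also have "\<dots> \<le> \<bar>real_of_int p / real q - real_of_int p' / real q'\<bar>"
    using \<open>1 \<le> \<bar>real_of_int d\<bar>\<close> by (simp add: eq abs_mult divide_right_mono)
  also have "\<dots> < 2 * (1 / 5 ^ n)"
  proof -
    define e :: real where "e = 1 / 5 ^ n"
    \<comment> \<open>The fractions are thus less than \<open>e + 2 * (e / 10)\<close> apart, well
      below \<open>2 * e\<close>.\<close>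
    have w: "1 / (2 * 5 ^ Suc n) = e / 10" by (simp add: e_def)
    have "\<bar>y - y'\<bar> \<le> e" using assms(3,4) by (auto simp: e_def)
    moreover have "0 < e" by (simp add: e_def)
    ultimately show ?thesis
      unfolding e_def[symmetric] using assms(1,2)[unfolded w] by linarith
  qed
  finally show False by simp
qed

text \<open>Here \<open>b\<close> is the left endpoint of an interval of level \<open>n + 1\<close>,
  tested only against the denominators small enough for its parent of level
  \<open>n\<close>.\<close>

definition clear_of_fractions :: "nat \<Rightarrow> real \<Rightarrow> bool" where
  "clear_of_fractions n b \<longleftrightarrow>
     (\<forall>y\<in>{b..b + 1 / 5 ^ Suc n}. \<forall>p q. 0 < q \<longrightarrow> 2 * (real q)\<^sup>2 < 5 ^ n \<longrightarrow>
       1 / (2 * 5 ^ Suc n) \<le> \<bar>y - real_of_int p / real q\<bar>)"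

lemma clear_children_exist:
  "\<exists>b b'. a \<le> b \<and> b + 2 / 5 ^ Suc n \<le> b' \<and> b' + 1 / 5 ^ Suc n \<le> a + 1 / 5 ^ n \<and>
     clear_of_fractions n b \<and> clear_of_fractions n b'"
proof -
  define h :: real where "h = 1 / 5 ^ Suc n"
  have h: "h > 0" "1 / 5 ^ n = 5 * h" "1 / (2 * 5 ^ Suc n) = h / 2" by (simp_all add: h_def)
  \<comment> \<open>If both were spoiled, it would be by the same fraction. But the two subintervals
    are at least \<open>h\<close> apart, so no fraction is within less than \<open>h / 2\<close> of
    both.\<close>
  have one: "clear_of_fractions n (a + s * h) \<or> clear_of_fractions n (a + t * h)"
    if st: "0 \<le> s" "s + 2 \<le> t" "t \<le> 4" for s t
  proof (rule ccontr)
    assume "\<not> ?thesis"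
    then obtain y p q y' p' q' where
        y: "y \<in> {a + s * h..a + s * h + h}" "0 < q" "2 * (real q)\<^sup>2 < 5 ^ n"
          "\<bar>y - real_of_int p / real q\<bar> < h / 2"
      and y': "y' \<in> {a + t * h..a + t * h + h}" "0 < q'" "2 * (real q')\<^sup>2 < 5 ^ n"
          "\<bar>y' - real_of_int p' / real q'\<bar> < h / 2"
      unfolding clear_of_fractions_def h(3) h_def[symmetric] by (meson not_le)
    have sh: "0 \<le> s * h" "t * h \<le> 4 * h" "(s + 2) * h \<le> t * h"
      using st h(1) by (auto intro: mult_right_mono)
    have mem: "y \<in> {a..a + 5 * h}" "y' \<in> {a..a + 5 * h}"
      using y(1) y'(1) sh h(1) unfolding atLeastAtMost_iff distrib_right by linarith+
    have "real_of_int p / real q = real_of_int p' / real q'"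
      by (rule at_most_one_fraction_near[of y _ _ n y' _ _ a, unfolded h(3)])
         (use y y' mem in \<open>simp_all only: h(2)\<close>)
    then show False
      using y(1,4) y'(1,4) sh h(1) unfolding atLeastAtMost_iff distrib_right abs_less_iff by linarith
  qed
  have "\<exists>s t. 0 \<le> s \<and> s + 2 \<le> t \<and> t \<le> 4 \<and>
      clear_of_fractions n (a + s * h) \<and> clear_of_fractions n (a + t * h)"
  proof (cases "clear_of_fractions n (a + 0 * h)")
    case True
    have "clear_of_fractions n (a + 2 * h) \<or> clear_of_fractions n (a + 4 * h)"
      by (rule one) auto
    then show ?thesis
    proof
      assume "clear_of_fractions n (a + 2 * h)"
      with True show ?thesis by (intro exI[of _ 0] exI[of _ 2]) simp
    next
      assume "clear_of_fractions n (a + 4 * h)"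
      with True show ?thesis by (intro exI[of _ 0] exI[of _ 4]) simp
    qed
  next
    case False
    then show ?thesis using one[of 0 2] one[of 0 4] by (intro exI[of _ 2] exI[of _ 4]) auto
  qed
  then obtain s t where st: "0 \<le> s" "s + 2 \<le> t" "t \<le> 4"
      "clear_of_fractions n (a + s * h)" "clear_of_fractions n (a + t * h)"
    by blast
  have sh: "0 \<le> s * h" "t * h \<le> 4 * h" "(s + 2) * h \<le> t * h"
    using st h(1) by (auto intro: mult_right_mono)
  have "2 / 5 ^ Suc n = 2 * h" by (simp add: h_def)
  then have "a + s * h + 2 / 5 ^ Suc n \<le> a + t * h" "a + t * h + h \<le> a + 1 / 5 ^ n"
    using sh unfolding h(2) distrib_right by linarith+
  then show ?thesis
    using st sh(1) unfolding h_def[symmetric]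
    by (intro exI[of _ "a + s * h"] exI[of _ "a + t * h"]) simp
qed

text \<open>This is the first level at which the denominator \<open>q\<close> is taken into account;
  minimality gives the upper bound.\<close>

lemma power_of_5_between_square:
  assumes "0 < q"
  obtains n where "2 * (real q)\<^sup>2 < 5 ^ n" "5 ^ n \<le> 10 * (real q)\<^sup>2"
proof -
  define n where "n = (LEAST n. 2 * (real q)\<^sup>2 < 5 ^ n)"
  have "\<exists>n. 2 * (real q)\<^sup>2 < 5 ^ n" by (rule real_arch_pow) simp
  then have n: "2 * (real q)\<^sup>2 < 5 ^ n" unfolding n_def by (rule LeastI_ex)
  have "1 \<le> (real q)\<^sup>2" using assms by simp
  have "5 ^ n \<le> 10 * (real q)\<^sup>2"
  proof (cases n)
    case 0
    then show ?thesis using \<open>1 \<le> (real q)\<^sup>2\<close> by simp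
  next
    case (Suc k)
    then have "\<not> 2 * (real q)\<^sup>2 < 5 ^ k" unfolding n_def by (intro not_less_Least) simp
    then show ?thesis using Suc by simp
  qed
  with n show ?thesis by (rule that)
qed

section \<open>The binary tree of intervals clear of fractions\<close>

definition clear_children :: "nat \<Rightarrow> real \<Rightarrow> real \<times> real" where
  "clear_children n a = (SOME (b, b').
     a \<le> b \<and> b + 2 / 5 ^ Suc n \<le> b' \<and> b' + 1 / 5 ^ Suc n \<le> a + 1 / 5 ^ n \<and>
     clear_of_fractions n b \<and> clear_of_fractions n b')"

lemma clear_children:
  "a \<le> fst (clear_children n a)"
  "fst (clear_children n a) + 2 / 5 ^ Suc n \<le> snd (clear_children n a)"
  "snd (clear_children n a) + 1 / 5 ^ Suc n \<le> a + 1 / 5 ^ n"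
  "clear_of_fractions n (fst (clear_children n a))"
  "clear_of_fractions n (snd (clear_children n a))"
proof -
  have "case clear_children n a of (b, b') \<Rightarrow>
     a \<le> b \<and> b + 2 / 5 ^ Suc n \<le> b' \<and> b' + 1 / 5 ^ Suc n \<le> a + 1 / 5 ^ n \<and>
     clear_of_fractions n b \<and> clear_of_fractions n b'"
    unfolding clear_children_def by (rule someI_ex) (use clear_children_exist[of a n] in simp)
  then show "a \<le> fst (clear_children n a)"
    "fst (clear_children n a) + 2 / 5 ^ Suc n \<le> snd (clear_children n a)"
    "snd (clear_children n a) + 1 / 5 ^ Suc n \<le> a + 1 / 5 ^ n"
    "clear_of_fractions n (fst (clear_children n a))"
    "clear_of_fractions n (snd (clear_children n a))"
    by (simp_all only: case_prod_beta)
qed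

text \<open>Every index of level 0 gives the unit interval, so the axioms of
  \<open>cantor_tree\<close> hold for all integers \<open>k\<close>. The measure only uses
  \<open>0 \<le> k\<close> and \<open>k < 2 ^ n\<close>.\<close>

primrec clear_left :: "nat \<Rightarrow> int \<Rightarrow> real" where
  "clear_left 0 k = 0"
| "clear_left (Suc n) k =
     (if even k then fst else snd) (clear_children n (clear_left n (k div 2)))"

lemma cantor_tree_clear_left: "cantor_tree clear_left"
proof
  fix n k
  let ?c = "clear_children n (clear_left n (k div 2))"
  have "(0::real) \<le> 1 / 5 ^ Suc n" "(2::real) / 5 ^ Suc n = 2 * (1 / 5 ^ Suc n)" by simp_all
  then have "fst ?c \<le> snd ?c"
    using clear_children(2)[of n "clear_left n (k div 2)"] by linarith
  then show "clear_left n (k div 2) \<le> clear_left (Suc n) k"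
    and "clear_left (Suc n) k + 1 / 5 ^ Suc n \<le> clear_left n (k div 2) + 1 / 5 ^ n"
    using clear_children(1,3)[where a = "clear_left n (k div 2)" and n = n]
    by (auto simp del: power_Suc)
  show "clear_left (Suc n) (2 * k) + 2 / 5 ^ Suc n \<le> clear_left (Suc n) (2 * k + 1)"
    using clear_children(2)[where a = "clear_left n k" and n = n] by simp
qed

lemma clear_left_clear: "clear_of_fractions n (clear_left (Suc n) k)"
  by (simp add: clear_children)

interpretation clear: cantor_tree clear_left
  by (rule cantor_tree_clear_left)

text \<open>The limit point lies in an interval of level \<open>n + 1\<close> that is clear of
  \<open>p / q\<close>, and \<open>5 ^ n \<le> 10 * (real q)\<^sup>2\<close> turns the distance
  \<open>1 / (2 * 5 ^ Suc n)\<close> into a multiple of \<open>1 / (real q)\<^sup>2\<close>.\<close>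

lemma limit_point_badly_approximable:
  assumes "0 < q"
  shows "1 / (100 * (real q)\<^sup>2) \<le> \<bar>clear.limit_point t - real_of_int p / real q\<bar>"
proof -
  obtain n where n: "2 * (real q)\<^sup>2 < 5 ^ n" "5 ^ n \<le> 10 * (real q)\<^sup>2"
    using power_of_5_between_square[OF assms] by blast
  have "1 / (100 * (real q)\<^sup>2) \<le> 1 / (2 * 5 ^ Suc n)"
    using n(2) assms by (intro divide_left_mono) auto
  also have "\<dots> \<le> \<bar>clear.limit_point t - real_of_int p / real q\<bar>"
    using clear_left_clear[of n "clear.code (Suc n) t"] clear.limit_point_bounds[of t "Suc n"] n(1) assms
    unfolding clear_of_fractions_def by blast
  finally show ?thesis .
qed

section \<open>The approximation function\<close>

text \<open>The shift by \<open>1\<close> keeps \<open>\<psi>\<^sub>0 0\<close> positive.\<close>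

definition \<psi>\<^sub>0 :: "nat \<Rightarrow> real" where
  "\<psi>\<^sub>0 q = 1 / (200 * (real q + 1)\<^sup>2)"

lemma psi0_pos: "0 < \<psi>\<^sub>0 q"
  by (simp add: \<psi>\<^sub>0_def add_pos_nonneg add_nonneg_pos)

lemma psi0_decseq: "decseq \<psi>\<^sub>0"
  unfolding \<psi>\<^sub>0_def by (intro decseq_SucI divide_left_mono mult_left_mono power_mono mult_pos_pos)
    (auto simp: add_nonneg_pos)

lemma psi0_less: "0 < q \<Longrightarrow> \<psi>\<^sub>0 q < 1 / (100 * (real q)\<^sup>2)"
  unfolding \<psi>\<^sub>0_def
proof (rule divide_strict_left_mono)
  assume "0 < q"
  then have "(real q)\<^sup>2 > 0" "(real q)\<^sup>2 \<le> (real q + 1)\<^sup>2" by (auto intro: power_mono)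
  then show "100 * (real q)\<^sup>2 < 200 * (real q + 1)\<^sup>2" by linarith
qed (auto intro!: mult_pos_pos simp: add_nonneg_pos)

lemma psi0_ge: "0 < q \<Longrightarrow> 1 / (800 * (real q)\<^sup>2) \<le> \<psi>\<^sub>0 q"
  unfolding \<psi>\<^sub>0_def
proof (rule divide_left_mono)
  assume "0 < q"
  then have "(real q + 1)\<^sup>2 \<le> (2 * real q)\<^sup>2" by (intro power_mono) auto
  then show "200 * (real q + 1)\<^sup>2 \<le> 800 * (real q)\<^sup>2" by (simp add: power_mult_distrib)
qed (auto intro!: mult_pos_pos simp: add_nonneg_pos)

text \<open>By \<open>psi0_ge\<close> the terms dominate the harmonic series divided by 800. The
  index \<open>Suc q\<close> makes the sum start at denominator 1.\<close>

lemma psi0_sum: "(\<Sum>q. ennreal (real (Suc q) * \<psi>\<^sub>0 (Suc q))) = \<infinity>"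
proof (rule ccontr)
  assume "(\<Sum>q. ennreal (real (Suc q) * \<psi>\<^sub>0 (Suc q))) \<noteq> \<infinity>"
  then have "summable (\<lambda>q. real (Suc q) * \<psi>\<^sub>0 (Suc q))"
    by (intro summable_suminf_not_top) (auto simp: psi0_pos less_imp_le)
  moreover have "norm (1 / 800 * inverse (real (Suc q))) \<le> real (Suc q) * \<psi>\<^sub>0 (Suc q)" for q
  proof -
    have "real (Suc q) * (1 / (800 * (real (Suc q))\<^sup>2)) \<le> real (Suc q) * \<psi>\<^sub>0 (Suc q)"
      by (intro mult_left_mono psi0_ge) auto
    moreover have "real (Suc q) * (1 / (800 * (real (Suc q))\<^sup>2)) = 1 / 800 * inverse (real (Suc q))"
      by (simp add: power2_eq_square divide_simps del: of_nat_Suc)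
    moreover have "norm (1 / 800 * inverse (real (Suc q))) = 1 / 800 * inverse (real (Suc q))"
      unfolding real_norm_def by (rule abs_of_nonneg) simp
    ultimately show ?thesis by (simp only:)
  qed
  ultimately have "summable (\<lambda>q. 1 / 800 * inverse (real (Suc q)))"
    by (rule summable_comparison_test'[where N = 0])
  then have "summable (\<lambda>q. inverse (real (Suc q)))" by (subst (asm) summable_cmult_iff) simp
  then show False using not_summable_harmonic[where 'a = real] by (subst (asm) summable_Suc_iff) simp
qed

text \<open>\<open>\<psi>\<^sub>0\<close> is strictly below the assumed distance, so not even one
  fraction qualifies.\<close>

lemma not_psi_approximable:
  assumes "\<And>(p::int) q. 0 < q \<Longrightarrow> 1 / (100 * (real q)\<^sup>2) \<le> \<bar>x - p / q\<bar>"
  shows "\<not> psi_approximable \<psi>\<^sub>0 x"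
proof -
  have "\<not> \<bar>x - of_int p / of_nat q\<bar> \<le> \<psi>\<^sub>0 q" if "q \<ge> 1" for p :: int and q
    using assms[of q p] psi0_less[of q] that by linarith
  then have "{(p :: int, q :: nat). q \<ge> 1 \<and> coprime p (int q) \<and> \<bar>x - of_int p / of_nat q\<bar> \<le> \<psi>\<^sub>0 q} = {}"
    by blast
  then show ?thesis unfolding psi_approximable_def by (simp only: finite.emptyI simp_thms)
qed

text \<open>A set of pairs is infinite iff no finite list exhausts it. Lists of pairs form a
  countable type, so infinitude becomes a countable combination of Borel conditions.\<close>

lemma psi_approximable_measurable: "{x. psi_approximable \<psi> x} \<in> sets borel"
proof -
  define P where "P x y \<longleftrightarrow> snd y \<ge> 1 \<and> coprime (fst y) (int (snd y)) \<and>
      \<bar>x - of_int (fst y) / of_nat (snd y)\<bar> \<le> \<psi> (snd y)"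
    for x :: real and y :: "int \<times> nat"
  have [measurable]: "Measurable.pred borel (\<lambda>x. P x y)" for y
    unfolding P_def by measurable
  have "infinite S \<longleftrightarrow> (\<forall>ys. \<exists>y. y \<notin> set ys \<and> y \<in> S)" for S :: "(int \<times> nat) set"
  proof
    assume "infinite S"
    then show "\<forall>ys. \<exists>y. y \<notin> set ys \<and> y \<in> S"
      by (metis List.finite_set finite_subset subsetI)
  next
    assume "\<forall>ys. \<exists>y. y \<notin> set ys \<and> y \<in> S"
    then show "infinite S" using finite_list by blast
  qed
  then have "infinite {y. P x y} \<longleftrightarrow> (\<forall>ys. \<exists>y. y \<notin> set ys \<and> P x y)" for x by simp
  then have "{x. infinite {y. P x y}} = {x\<in>space borel. \<forall>ys. \<exists>y. y \<notin> set ys \<and> P x y}" by simp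
  also have "\<dots> \<in> sets borel" by measurable
  finally have *: "{x. infinite {y. P x y}} \<in> sets borel" .
  have "\<rat> \<in> sets (borel :: real measure)"
    using countable_rat by (rule sets.countable[rotated]) simp
  then have "- \<rat> \<inter> {x. infinite {y. P x y}} \<in> sets borel"
    using * by (intro sets.Int borel_comp)
  moreover have "{(p :: int, q :: nat). q \<ge> 1 \<and> coprime p (int q) \<and>
      \<bar>x - of_int p / of_nat q\<bar> \<le> \<psi> q} = {y. P x y}" for x
    by (auto simp: P_def)
  then have "- \<rat> \<inter> {x. infinite {y. P x y}} = {x. psi_approximable \<psi> x}"
    by (auto simp: psi_approximable_def)
  ultimately show ?thesis by simp
qed

lemma emeasure_psi0_approximable: "emeasure clear.cantor_measure {x. psi_approximable \<psi>\<^sub>0 x} = 0"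
proof -
  have "\<not> psi_approximable \<psi>\<^sub>0 (clear.limit_point t)" for t
    by (rule not_psi_approximable) (rule limit_point_badly_approximable)
  then show ?thesis
    by (simp add: clear.emeasure_cantor_measure psi_approximable_measurable)
qed

section \<open>Lebesgue measure\<close>

definition fractions :: "nat \<Rightarrow> (int \<times> nat) set" where
  "fractions N = {(p, q). 0 \<le> p \<and> p \<le> int q \<and> q \<le> N \<and> N < 8 * q \<and> coprime p (int q)}"

lemma finite_fractions: "finite (fractions N)"
  by (rule finite_subset[of _ "{0..int N} \<times> {0..N}"]) (auto simp: fractions_def)

text \<open>By Dirichlet's theorem the intervals of radius \<open>1 / (q N)\<close> around the fractions with
  denominator at most \<open>N\<close> cover the unit interval, and those with \<open>8 q \<le> N\<close> have total length at most \<open>1 / 2\<close>.\<close>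

lemma card_fractions_ge:
  assumes "0 < N"
  shows "(real N)\<^sup>2 / 32 \<le> real (card (fractions N))"
proof -
  \<comment> \<open>These fractions need not be reduced, since only an upper bound for the total
    length of their intervals is wanted.\<close>
  define S where "S = {(p, q). 0 \<le> p \<and> p \<le> int q \<and> 1 \<le> q \<and> 8 * q \<le> N}"
  have S_eq: "S = (\<lambda>(q, p). (p, q)) ` (SIGMA q:{1..N div 8}. {0..int q})"
    by (auto simp: S_def image_iff)
  have finS: "finite S" unfolding S_eq by auto
  define I where "I p q r = {real_of_int p / real q - r..real_of_int p / real q + r}" for p :: int and q r
  have I: "emeasure lborel (I p q r) = ennreal (2 * r)" if "0 \<le> r" for p q r
    using that by (simp add: I_def)
  \<comment> \<open>For \<open>N < 8 * q\<close> the Dirichlet radius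
    \<open>1 / (real q * real N)\<close> is at most \<open>8 / (real N)\<^sup>2\<close>, which is
    the same for all \<open>q\<close>.\<close>
  let ?A = "\<lambda>(p, q). I p q (1 / (real q * real N))" and ?B = "\<lambda>(p, q). I p q (8 / (real N)\<^sup>2)"
  have A: "?A z \<in> sets lborel" and B: "?B z \<in> sets lborel" for z
    by (cases z; simp add: I_def)+
  have UA: "(\<Union>z\<in>S. ?A z) \<in> sets lborel" and UB: "(\<Union>z\<in>fractions N. ?B z) \<in> sets lborel"
    using finS finite_fractions A B by (intro sets.finite_UN; blast)+
  have "{0..1} \<subseteq> (\<Union>z\<in>S. ?A z) \<union> (\<Union>z\<in>fractions N. ?B z)"
  proof
    fix x :: real assume x: "x \<in> {0..1}"
    obtain h k where hk: "coprime h k" "0 < k" "k \<le> int N" "\<bar>of_int k * x - of_int h\<bar> < 1 / N"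
      using Dirichlet_approx_coprime[OF assms] by blast
    define q where "q = nat k"
    have k: "k = int q" "0 < q" "q \<le> N" using hk by (auto simp: q_def)
    have "1 / real N \<le> 1" using assms by simp
    then have *: "\<bar>real q * x - h\<bar> < 1" using hk(4) k(1) by simp
    have "0 \<le> real q * x" "real q * x \<le> real q" using x by (auto intro: mult_left_le)
    with * have "-1 < real_of_int h" "real_of_int h < real q + 1" by linarith+
    then have h: "0 \<le> h" "h \<le> int q" by linarith+
    have "\<bar>x - h / q\<bar> = \<bar>real q * x - h\<bar> / q"
    proof -
      have "x - h / q = (real q * x - h) / q" using k(2) by (simp add: field_simps)
      then show ?thesis by (simp add: abs_divide)
    qed
    also have "\<dots> \<le> 1 / (real q * real N)"
      using hk(4) k by (simp add: field_simps)
    finally have d: "\<bar>x - h / q\<bar> \<le> 1 / (real q * real N)" .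
    show "x \<in> (\<Union>z\<in>S. ?A z) \<union> (\<Union>z\<in>fractions N. ?B z)"
    proof (cases "8 * q \<le> N")
      case True
      then have "(h, q) \<in> S" "x \<in> ?A (h, q)" using h k d by (auto simp: S_def I_def abs_le_iff)
      then show ?thesis by blast
    next
      case False
      then have "real N * real N \<le> 8 * real q * real N" by (intro mult_right_mono) auto
      then have "1 / (real q * real N) \<le> 8 / (real N)\<^sup>2"
        using assms k(2) by (simp add: field_simps power2_eq_square)
      then have "(h, q) \<in> fractions N" "x \<in> ?B (h, q)"
        using h k d hk(1) False by (auto simp: fractions_def I_def abs_le_iff)
      then show ?thesis by blast
    qed
  qed
  then have "emeasure lborel {0..1::real} \<le> emeasure lborel ((\<Union>z\<in>S. ?A z) \<union> (\<Union>z\<in>fractions N. ?B z))"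
    using UA UB by (intro emeasure_mono) auto
  also have "\<dots> \<le> emeasure lborel (\<Union>z\<in>S. ?A z) + emeasure lborel (\<Union>z\<in>fractions N. ?B z)"
    using UA UB by (intro emeasure_subadditive) auto
  also have "\<dots> \<le> (\<Sum>z\<in>S. emeasure lborel (?A z)) + (\<Sum>z\<in>fractions N. emeasure lborel (?B z))"
    using finS finite_fractions A B by (intro add_mono emeasure_subadditive_finite) blast+
  also have "(\<Sum>z\<in>S. emeasure lborel (?A z)) = (\<Sum>z\<in>S. ennreal (2 / (real (snd z) * real N)))"
    by (intro sum.cong) (auto simp: I)
  also have "\<dots> = ennreal (\<Sum>z\<in>S. 2 / (real (snd z) * real N))"
    by (rule sum_ennreal) simp
  also have "(\<Sum>z\<in>fractions N. emeasure lborel (?B z)) = (\<Sum>z\<in>fractions N. ennreal (16 / (real N)\<^sup>2))"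
    by (intro sum.cong) (auto simp: I)
  also have "\<dots> = ennreal (real (card (fractions N)) * (16 / (real N)\<^sup>2))"
    by (subst sum_ennreal) auto
  also have "ennreal (\<Sum>z\<in>S. 2 / (real (snd z) * real N)) + \<dots>
      = ennreal ((\<Sum>z\<in>S. 2 / (real (snd z) * real N)) + real (card (fractions N)) * (16 / (real N)\<^sup>2))"
    by (intro ennreal_plus[symmetric] sum_nonneg) auto
  finally have "1 \<le> (\<Sum>z\<in>S. 2 / (real (snd z) * real N)) + real (card (fractions N)) * (16 / (real N)\<^sup>2)"
    by simp
  \<comment> \<open>Each \<open>q\<close> has \<open>q + 1 \<le> 2 * q\<close> numerators with
    intervals of length \<open>2 / (real q * real N)\<close>, so it contributes at most
    \<open>4 / real N\<close>, and there are at most \<open>N / 8\<close> such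
    \<open>q\<close>.\<close>
  moreover have "(\<Sum>z\<in>S. 2 / (real (snd z) * real N)) \<le> 1 / 2"
  proof -
    have "(\<Sum>z\<in>S. 2 / (real (snd z) * real N))
        = (\<Sum>(q, p)\<in>(SIGMA q:{1..N div 8}. {0..int q}). 2 / (real q * real N))"
      unfolding S_eq by (subst sum.reindex) (auto simp: inj_on_def case_prod_beta)
    also have "\<dots> = (\<Sum>q\<in>{1..N div 8}. \<Sum>p\<in>{0..int q}. 2 / (real q * real N))"
      by (rule sum.Sigma[symmetric]) auto
    also have "\<dots> \<le> (\<Sum>q\<in>{1..N div 8}. 4 / real N)"
    proof (rule sum_mono)
      fix q assume "q \<in> {1..N div 8}"
      then have q: "1 \<le> real q" by auto
      have "(\<Sum>p\<in>{0..int q}. 2 / (real q * real N)) = (real q + 1) * (2 / (real q * real N))"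
        by simp
      also have "\<dots> \<le> (2 * real q) * (2 / (real q * real N))"
        using q by (intro mult_right_mono) auto
      also have "\<dots> = 4 / real N" using q by simp
      finally show "(\<Sum>p\<in>{0..int q}. 2 / (real q * real N)) \<le> 4 / real N" .
    qed
    also have "\<dots> = real (N div 8) * (4 / real N)" by simp
    also have "\<dots> \<le> (real N / 8) * (4 / real N)" by (intro mult_right_mono) (linarith, simp)
    also have "\<dots> = 1 / 2" using assms by simp
    finally show ?thesis .
  qed
  ultimately have "1 / 2 \<le> real (card (fractions N)) * (16 / (real N)\<^sup>2)" by linarith
  then show ?thesis using assms by (simp add: field_simps)
qed

section \<open>Balls around reduced fractions and their limsup set\<close>

definition near_fractions :: "real \<Rightarrow> nat \<Rightarrow> real set" where
  "near_fractions c N = (\<Union>(p, q)\<in>fractions N. ball (real_of_int p / real q) (c / (real N)\<^sup>2))"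

text \<open>The numerator \<open>d\<close> of the difference is a nonzero integer, because a reduced
  fraction is determined by its value, and the denominator is at most
  \<open>(real N)\<^sup>2\<close>.\<close>

lemma fractions_separated:
  assumes "(p, q) \<in> fractions N" "(p', q') \<in> fractions N" "(p, q) \<noteq> (p', q')"
  shows "1 / (real N)\<^sup>2 \<le> \<bar>real_of_int p / real q - real_of_int p' / real q'\<bar>"
proof -
  have q: "0 < q" "0 < q'" "q \<le> N" "q' \<le> N" "coprime p (int q)" "coprime p' (int q')"
    using assms by (auto simp: fractions_def)
  define d where "d = p * int q' - p' * int q"
  have "d \<noteq> 0"
  proof
    assume "d = 0"
    then have eq: "p * int q' = p' * int q" by (simp add: d_def)
    then have "int q dvd p * int q'" "int q' dvd p' * int q" by (metis dvd_triv_right)+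
    then have "int q dvd int q'" "int q' dvd int q"
      using q(5,6) by (simp_all add: coprime_commute coprime_dvd_mult_right_iff)
    then have "q = q'" by (simp add: dvd_antisym)
    with eq q assms(3) show False by simp
  qed
  then have d: "1 \<le> \<bar>real_of_int d\<bar>" by linarith
  have eq: "real_of_int p / real q - real_of_int p' / real q' = real_of_int d / (real q * real q')"
    using q(1,2) by (simp add: d_def field_simps)
  have "1 / (real N)\<^sup>2 \<le> 1 / (real q * real q')"
    using q by (auto simp: power2_eq_square intro!: divide_left_mono mult_mono)
  also have "\<dots> \<le> \<bar>real_of_int d\<bar> / (real q * real q')"
    using d by (intro divide_right_mono) auto
  finally show ?thesis by (simp add: eq abs_mult)
qed

lemma near_fractions_measurable: "near_fractions c N \<in> sets borel"
  unfolding near_fractions_def using finite_fractions by (intro sets.finite_UN) auto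

text \<open>The centres are at least \<open>1 / (real N)\<^sup>2\<close> apart and the radii at most
  half of that, so the balls are disjoint and their lengths add up.\<close>

lemma emeasure_near_fractions_ge:
  assumes "0 < N" "0 < c" "2 * c \<le> 1"
  shows "ennreal (c / 16) \<le> emeasure lborel (near_fractions c N)"
proof -
  let ?B = "\<lambda>(p :: int, q :: nat). ball (real_of_int p / real q) (c / (real N)\<^sup>2)"
  have "disjoint_family_on ?B (fractions N)"
    unfolding disjoint_family_on_def
  proof (intro ballI impI)
    fix z z' assume z: "z \<in> fractions N" "z' \<in> fractions N" "z \<noteq> z'"
    obtain p q p' q' where zz': "z = (p, q)" "z' = (p', q')" by fastforce
    have *: "(p, q) \<in> fractions N" "(p', q') \<in> fractions N" "(p, q) \<noteq> (p', q')"
      using z unfolding zz' .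
    have "2 * (c / (real N)\<^sup>2) \<le> 1 / (real N)\<^sup>2"
      using assms divide_right_mono[OF assms(3), of "(real N)\<^sup>2"] by simp
    also have "\<dots> \<le> dist (real_of_int p / real q) (real_of_int p' / real q')"
      using fractions_separated[OF *] by (simp add: dist_real_def)
    finally show "?B z \<inter> ?B z' = {}" unfolding zz' by (simp add: disjoint_ballI)
  qed
  then have "emeasure lborel (near_fractions c N) = (\<Sum>z\<in>fractions N. emeasure lborel (?B z))"
    unfolding near_fractions_def using finite_fractions by (intro sum_emeasure[symmetric]) auto
  also have "\<dots> = (\<Sum>z\<in>fractions N. ennreal (2 * c / (real N)\<^sup>2))"
    using assms by (intro sum.cong) (auto simp: ball_eq_greaterThanLessThan)
  also have "\<dots> = ennreal (real (card (fractions N)) * (2 * c / (real N)\<^sup>2))"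
    using assms by (subst sum_ennreal) auto
  finally have *: "emeasure lborel (near_fractions c N) = \<dots>" .
  have "c / 16 = (real N)\<^sup>2 / 32 * (2 * c / (real N)\<^sup>2)" using assms by simp
  also have "\<dots> \<le> real (card (fractions N)) * (2 * c / (real N)\<^sup>2)"
    using card_fractions_ge[OF assms(1)] assms by (intro mult_right_mono) auto
  finally show ?thesis unfolding * by (rule ennreal_leI)
qed

text \<open>The limsup of the sets \<open>near_fractions c N\<close> consists of approximable and
  rational numbers, and continuity from above along the tails \<open>B n\<close> gives it measure at
  least \<open>c / 16\<close>.\<close>

lemma psi_approximable_not_null:
  assumes "0 < c" "2 * c \<le> 1" "\<And>q. 0 < q \<Longrightarrow> c / (real q)\<^sup>2 \<le> \<psi> q"
  shows "{x. psi_approximable \<psi> x} \<notin> null_sets lborel"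
proof
  assume null: "{x. psi_approximable \<psi> x} \<in> null_sets lborel"
  \<comment> \<open>Rationals may lie in the limsup but never count as approximable; adjoining this
    null set absorbs them.\<close>
  have nullU: "{x. psi_approximable \<psi> x} \<union> \<rat> \<in> null_sets lborel"
    using null countable_imp_null_set_lborel[OF countable_rat] by (rule null_sets.Un)
  define B where "B n = (\<Union>N\<in>{n<..}. near_fractions c N)" for n
  have meas: "B n \<in> sets lborel" for n
    unfolding B_def using near_fractions_measurable by auto
  \<comment> \<open>Boundedness yields the finite measure that continuity from above
    requires.\<close>
  have "B n \<subseteq> ball 0 2" for n
  proof
    fix x assume "x \<in> B n"
    then obtain N where "n < N" "x \<in> near_fractions c N" by (auto simp: B_def)
    then obtain p q where N: "0 < N" and pq: "(p, q) \<in> fractions N"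
        and x: "x \<in> ball (real_of_int p / real q) (c / (real N)\<^sup>2)"
      by (auto simp: near_fractions_def)
    have "0 \<le> real_of_int p / real q" "real_of_int p / real q \<le> 1"
      using pq by (auto simp: fractions_def divide_le_eq_1)
    moreover have "c / (real N)\<^sup>2 \<le> c / 1"
      using assms(1) N by (intro divide_left_mono) auto
    ultimately show "x \<in> ball 0 2" using x assms(2) by (auto simp: dist_real_def)
  qed
  then have "emeasure lborel (B n) \<le> emeasure lborel (ball 0 2 :: real set)" for n
    by (intro emeasure_mono) auto
  then have "emeasure lborel (B n) < \<infinity>" for n
    by (rule le_less_trans) (rule emeasure_lborel_ball_finite)
  then have fin: "emeasure lborel (B n) \<noteq> \<infinity>" for n
    by (rule less_imp_neq)
  have "decseq B" unfolding B_def by (intro decseq_SucI UN_mono) auto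
  have "ennreal (c / 16) \<le> (INF n. emeasure lborel (B n))"
  proof (rule INF_greatest)
    fix n
    have "ennreal (c / 16) \<le> emeasure lborel (near_fractions c (Suc n))"
      using assms(1,2) by (intro emeasure_near_fractions_ge) auto
    also have "\<dots> \<le> emeasure lborel (B n)"
      using meas by (intro emeasure_mono) (auto simp: B_def)
    finally show "ennreal (c / 16) \<le> emeasure lborel (B n)" .
  qed
  also have "\<dots> = emeasure lborel (\<Inter>n. B n)"
    using meas fin \<open>decseq B\<close> by (intro INF_emeasure_decseq) auto
  also have "\<dots> \<le> emeasure lborel ({x. psi_approximable \<psi> x} \<union> \<rat>)"
  proof (rule emeasure_mono)
    show "{x. psi_approximable \<psi> x} \<union> \<rat> \<in> sets lborel"
      using nullU by (rule null_setsD2)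
    show "(\<Inter>n. B n) \<subseteq> {x. psi_approximable \<psi> x} \<union> \<rat>"
    proof
      fix x assume x: "x \<in> (\<Inter>n. B n)"
      let ?S = "{(p :: int, q :: nat). q \<ge> 1 \<and> coprime p (int q) \<and> \<bar>x - of_int p / of_nat q\<bar> \<le> \<psi> q}"
      have "\<exists>q>n. q \<in> snd ` ?S" for n
      proof -
        \<comment> \<open>The factor 8 offsets the condition \<open>N < 8 * q\<close>: together with
          \<open>8 * n < N\<close> it gives \<open>n < q\<close>.\<close>
        have "x \<in> B (8 * n)" using x by blast
        then obtain N where N: "8 * n < N" "x \<in> near_fractions c N" by (auto simp: B_def)
        then obtain p q where pq: "(p, q) \<in> fractions N"
            and d: "x \<in> ball (real_of_int p / real q) (c / (real N)\<^sup>2)"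
          by (auto simp: near_fractions_def)
        have q: "0 < q" "q \<le> N" "n < q" "coprime p (int q)" using pq N by (auto simp: fractions_def)
        have "c / (real N)\<^sup>2 \<le> c / (real q)\<^sup>2"
          using assms(1) q by (intro divide_left_mono power_mono) auto
        also have "\<dots> \<le> \<psi> q" using assms(3) q(1) by blast
        finally have "(p, q) \<in> ?S" using d q by (auto simp: dist_real_def)
        then have "q \<in> snd ` ?S" by force
        with q(3) show ?thesis by blast
      qed
      \<comment> \<open>Unbounded denominators ensure infinitely many different fractions, even if
        one fraction serves several \<open>N\<close>.\<close>
      then have "infinite (snd ` ?S)" unfolding infinite_nat_iff_unbounded by blast
      then have "infinite ?S" by blast
      then show "x \<in> {x. psi_approximable \<psi> x} \<union> \<rat>" unfolding psi_approximable_def by blast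
    qed
  qed
  also have "\<dots> = 0"
    using nullU by (rule null_setsD1)
  finally show False using assms(1) by simp
qed

section \<open>Sums of decaying measures\<close>

lemma abs_alpha_decaying_lborel: "abs_alpha_decaying 1 lborel"
proof -
  have ball: "emeasure lborel (ball x r) = ennreal (2 * r)" if "0 \<le> r" for x r :: real
    using that by (simp add: ball_eq_greaterThanLessThan)
  have "emeasure lborel (ball x (\<epsilon> * r)) \<le> ennreal (1 * \<epsilon> powr 1) * emeasure lborel (ball x r)"
    if "0 < r" "0 < \<epsilon>" for x r \<epsilon> :: real
    using that by (simp add: ball ennreal_mult'[symmetric] mult.left_commute)
  moreover have "borel_locally_finite lborel"
    unfolding borel_locally_finite_def using emeasure_lborel_ball_finite[of _ 1]
    by (auto intro!: exI[of _ 1])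
  ultimately show ?thesis unfolding abs_alpha_decaying_def by (blast intro: zero_less_one)
qed

text \<open>The space and the \<sigma>-algebra are taken from \<open>M\<close>; the intended use is
  for \<open>N\<close> with the same measurable sets.\<close>

definition sum_measure :: "'a measure \<Rightarrow> 'a measure \<Rightarrow> 'a measure" where
  "sum_measure M N = measure_of (space M) (sets M) (\<lambda>A. emeasure M A + emeasure N A)"

lemma sets_sum_measure [simp]: "sets (sum_measure M N) = sets M"
  by (simp add: sum_measure_def)

lemma emeasure_sum_measure:
  assumes "sets N = sets M" "A \<in> sets M"
  shows "emeasure (sum_measure M N) A = emeasure M A + emeasure N A"
  unfolding sum_measure_def
proof (rule emeasure_measure_of_sigma)
  show "sigma_algebra (space M) (sets M)" by (rule sets.sigma_algebra_axioms)
  show "positive (sets M) (\<lambda>A. emeasure M A + emeasure N A)" by (simp add: positive_def)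
  show "countably_additive (sets M) (\<lambda>A. emeasure M A + emeasure N A)"
  proof (rule countably_additiveI)
    fix F :: "nat \<Rightarrow> 'a set"
    assume F: "range F \<subseteq> sets M" "disjoint_family F"
    have "(\<Sum>i. emeasure M (F i) + emeasure N (F i)) = (\<Sum>i. emeasure M (F i)) + (\<Sum>i. emeasure N (F i))"
      by (intro suminf_add[symmetric]) auto
    also have "\<dots> = emeasure M (\<Union>(range F)) + emeasure N (\<Union>(range F))"
      using F assms(1) by (simp add: suminf_emeasure)
    finally show "(\<Sum>i. emeasure M (F i) + emeasure N (F i)) = emeasure M (\<Union>(range F)) + emeasure N (\<Union>(range F))" .
  qed
qed (rule assms(2))

text \<open>For \<open>\<epsilon> \<le> 1\<close> lowering the exponent only enlarges the power, so
  the same constant works.\<close>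

lemma abs_alpha_decaying_mono:
  assumes "abs_alpha_decaying \<alpha> \<mu>" "\<beta> \<le> \<alpha>"
  shows "abs_alpha_decaying \<beta> \<mu>"
proof -
  obtain C where C: "C > 0" "\<And>x r \<epsilon>. 0 < r \<and> r \<le> 1 \<and> 0 < \<epsilon> \<and> \<epsilon> \<le> 1 \<Longrightarrow>
      emeasure \<mu> (ball x (\<epsilon> * r)) \<le> ennreal (C * \<epsilon> powr \<alpha>) * emeasure \<mu> (ball x r)"
    using assms(1) unfolding abs_alpha_decaying_def by blast
  have "emeasure \<mu> (ball x (\<epsilon> * r)) \<le> ennreal (C * \<epsilon> powr \<beta>) * emeasure \<mu> (ball x r)"
    if "0 < r \<and> r \<le> 1 \<and> 0 < \<epsilon> \<and> \<epsilon> \<le> 1" for x r \<epsilon>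
  proof -
    have "C * \<epsilon> powr \<alpha> \<le> C * \<epsilon> powr \<beta>"
      using C(1) that assms(2) by (intro mult_left_mono powr_mono') auto
    then show ?thesis
      using C(2)[OF that, of x] by (meson ennreal_leI mult_right_mono order_trans zero_le)
  qed
  with C(1) assms(1) show ?thesis unfolding abs_alpha_decaying_def by blast
qed

text \<open>With the smaller exponent and the larger constant both measures satisfy the bound with a
  common factor, and the two inequalities add.\<close>

lemma absolutely_decaying_sum_measure:
  assumes "absolutely_decaying \<mu>" "absolutely_decaying \<nu>"
  shows "absolutely_decaying (sum_measure \<mu> \<nu>)"
proof -
  obtain \<alpha> \<beta> where "\<alpha> > 0" "\<beta> > 0" "abs_alpha_decaying \<alpha> \<mu>" "abs_alpha_decaying \<beta> \<nu>"
    using assms unfolding absolutely_decaying_def by blast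
  define \<gamma> where "\<gamma> = min \<alpha> \<beta>"
  have \<mu>: "abs_alpha_decaying \<gamma> \<mu>" and \<nu>: "abs_alpha_decaying \<gamma> \<nu>"
    using \<open>abs_alpha_decaying \<alpha> \<mu>\<close> \<open>abs_alpha_decaying \<beta> \<nu>\<close>
    by (auto simp: \<gamma>_def intro: abs_alpha_decaying_mono)
  obtain C where C: "C > 0" "\<And>x r \<epsilon>. 0 < r \<and> r \<le> 1 \<and> 0 < \<epsilon> \<and> \<epsilon> \<le> 1 \<Longrightarrow>
      emeasure \<mu> (ball x (\<epsilon> * r)) \<le> ennreal (C * \<epsilon> powr \<gamma>) * emeasure \<mu> (ball x r)"
    using \<mu> unfolding abs_alpha_decaying_def by blast
  obtain D where D: "D > 0" "\<And>x r \<epsilon>. 0 < r \<and> r \<le> 1 \<and> 0 < \<epsilon> \<and> \<epsilon> \<le> 1 \<Longrightarrow>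
      emeasure \<nu> (ball x (\<epsilon> * r)) \<le> ennreal (D * \<epsilon> powr \<gamma>) * emeasure \<nu> (ball x r)"
    using \<nu> unfolding abs_alpha_decaying_def by blast
  have sets: "sets \<mu> = sets borel" "sets \<nu> = sets borel"
    and fin: "\<And>x. \<exists>r>0. emeasure \<mu> (ball x r) < \<infinity>" "\<And>x. \<exists>r>0. emeasure \<nu> (ball x r) < \<infinity>"
    using \<mu> \<nu> unfolding abs_alpha_decaying_def borel_locally_finite_def by blast+
  have sum: "emeasure (sum_measure \<mu> \<nu>) (ball x r) = emeasure \<mu> (ball x r) + emeasure \<nu> (ball x r)"
    for x r by (rule emeasure_sum_measure) (simp_all add: sets)
  have "\<exists>r>0. emeasure (sum_measure \<mu> \<nu>) (ball x r) < \<infinity>" for x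
  proof -
    obtain r s where r: "r > 0" "emeasure \<mu> (ball x r) < \<infinity>" and s: "s > 0" "emeasure \<nu> (ball x s) < \<infinity>"
      using fin by blast
    have "emeasure \<mu> (ball x (min r s)) \<le> emeasure \<mu> (ball x r)"
      "emeasure \<nu> (ball x (min r s)) \<le> emeasure \<nu> (ball x s)"
      by (intro emeasure_mono; simp add: sets subset_ball)+
    then have "emeasure (sum_measure \<mu> \<nu>) (ball x (min r s)) < \<infinity>"
      using r(2) s(2) unfolding sum by (auto simp: ennreal_add_less_top)
    then show ?thesis using r(1) s(1) by (intro exI[of _ "min r s"]) simp
  qed
  then have "borel_locally_finite (sum_measure \<mu> \<nu>)"
    unfolding borel_locally_finite_def by (simp add: sets)
  moreover have "emeasure (sum_measure \<mu> \<nu>) (ball x (\<epsilon> * r))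
      \<le> ennreal (max C D * \<epsilon> powr \<gamma>) * emeasure (sum_measure \<mu> \<nu>) (ball x r)"
    if "0 < r \<and> r \<le> 1 \<and> 0 < \<epsilon> \<and> \<epsilon> \<le> 1" for x r \<epsilon>
  proof -
    have "ennreal (C * \<epsilon> powr \<gamma>) \<le> ennreal (max C D * \<epsilon> powr \<gamma>)"
      "ennreal (D * \<epsilon> powr \<gamma>) \<le> ennreal (max C D * \<epsilon> powr \<gamma>)"
      by (intro ennreal_leI mult_right_mono; simp)+
    then have "emeasure \<mu> (ball x (\<epsilon> * r)) \<le> ennreal (max C D * \<epsilon> powr \<gamma>) * emeasure \<mu> (ball x r)"
      "emeasure \<nu> (ball x (\<epsilon> * r)) \<le> ennreal (max C D * \<epsilon> powr \<gamma>) * emeasure \<nu> (ball x r)"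
      using C(2)[OF that, of x] D(2)[OF that, of x] by (meson mult_right_mono order_trans zero_le)+
    then show ?thesis unfolding sum distrib_left by (rule add_mono)
  qed
  moreover have "max C D > 0" using C(1) by simp
  ultimately have "abs_alpha_decaying \<gamma> (sum_measure \<mu> \<nu>)"
    unfolding abs_alpha_decaying_def by blast
  moreover have "\<gamma> > 0" using \<open>\<alpha> > 0\<close> \<open>\<beta> > 0\<close> by (simp add: \<gamma>_def)
  ultimately show ?thesis unfolding absolutely_decaying_def by blast
qed

section \<open>Lebesgue plus Cantor measure for (a), the Cantor measure alone for (b)\<close>

theorem corollary1p7:
  shows "(\<exists>(\<mu> :: real measure) (\<psi> :: nat \<Rightarrow> real).
            emeasure \<mu> UNIV \<noteq> 0 \<and> absolutely_decaying \<mu> \<and>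
            (\<forall>q. 0 < \<psi> q) \<and> decseq \<psi> \<and>
            emeasure \<mu> {x. psi_approximable \<psi> x} \<noteq> 0 \<and>
            emeasure \<mu> (- {x. psi_approximable \<psi> x}) \<noteq> 0)
       \<and> (\<exists>(\<mu> :: real measure) (\<psi> :: nat \<Rightarrow> real).
            emeasure \<mu> UNIV \<noteq> 0 \<and> absolutely_decaying \<mu> \<and>
            (\<forall>q. 0 < \<psi> q) \<and> decseq \<psi> \<and>
            \<not> ((AE x in \<mu>. psi_approximable \<psi> x) \<longleftrightarrow>
                (\<Sum>q. ennreal (real (Suc q) * \<psi> (Suc q))) = \<infinity>))"
proof (rule conjI)
  let ?\<nu> = clear.cantor_measure and ?A = "{x. psi_approximable \<psi>\<^sub>0 x}"
  have A: "?A \<in> sets borel" by (rule psi_approximable_measurable)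
  then have "emeasure ?\<nu> UNIV = emeasure ?\<nu> ?A + emeasure ?\<nu> (- ?A)"
    by (subst plus_emeasure) (auto simp: clear.sets_cantor_measure)
  then have cA: "emeasure ?\<nu> (- ?A) = 1"
    by (simp add: emeasure_psi0_approximable clear.emeasure_cantor_measure_UNIV)
  have \<nu>: "absolutely_decaying ?\<nu>"
    unfolding absolutely_decaying_def
    using clear.abs_alpha_decaying_cantor_measure by (intro exI[of _ "log 5 2"]) simp
  have "absolutely_decaying lborel"
    unfolding absolutely_decaying_def using abs_alpha_decaying_lborel zero_less_one by blast
  then have "absolutely_decaying (sum_measure lborel ?\<nu>)"
    using \<nu> by (rule absolutely_decaying_sum_measure)
  moreover have sum: "emeasure (sum_measure lborel ?\<nu>) B = emeasure lborel B + emeasure ?\<nu> B"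
    if "B \<in> sets borel" for B
    using that by (intro emeasure_sum_measure) (simp_all add: clear.sets_cantor_measure)
  \<comment> \<open>Lebesgue measure charges the approximable set and the Cantor measure charges its
    complement, so their sum charges both.\<close>
  have "?A \<notin> null_sets lborel"
    by (rule psi_approximable_not_null[of "1 / 800"]) (use psi0_ge in simp_all)
  with A have "emeasure lborel ?A \<noteq> 0" by (simp add: null_sets_def)
  then have "emeasure (sum_measure lborel ?\<nu>) ?A \<noteq> 0" by (simp add: sum A)
  moreover have "emeasure (sum_measure lborel ?\<nu>) (- ?A) \<noteq> 0"
    using sum[OF borel_comp[OF A]] by (simp add: cA)
  moreover have "emeasure (sum_measure lborel ?\<nu>) UNIV \<noteq> 0"
    using sum[of UNIV] by (simp add: clear.emeasure_cantor_measure_UNIV)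
  ultimately show "\<exists>\<mu> \<psi>. emeasure \<mu> UNIV \<noteq> 0 \<and> absolutely_decaying \<mu> \<and>
      (\<forall>q. 0 < \<psi> q) \<and> decseq \<psi> \<and>
      emeasure \<mu> {x. psi_approximable \<psi> x} \<noteq> 0 \<and> emeasure \<mu> (- {x. psi_approximable \<psi> x}) \<noteq> 0"
    using psi0_pos psi0_decseq by blast
  \<comment> \<open>Since \<open>psi0_sum\<close> makes the series side true, the equivalence fails
    once the almost-everywhere side is false.\<close>
  have "\<not> (AE x in ?\<nu>. psi_approximable \<psi>\<^sub>0 x)"
  proof
    assume "AE x in ?\<nu>. psi_approximable \<psi>\<^sub>0 x"
    then have "emeasure ?\<nu> (- ?A) = 0"
      using A by (subst (asm) AE_iff_measurable[where N = "- ?A"])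
        (auto simp: clear.sets_cantor_measure sets_eq_imp_space_eq[OF clear.sets_cantor_measure])
    then show False by (simp add: cA)
  qed
  moreover have "emeasure ?\<nu> UNIV \<noteq> 0" by (simp add: clear.emeasure_cantor_measure_UNIV)
  ultimately show "\<exists>\<mu> \<psi>. emeasure \<mu> UNIV \<noteq> 0 \<and> absolutely_decaying \<mu> \<and>
      (\<forall>q. 0 < \<psi> q) \<and> decseq \<psi> \<and>
      \<not> ((AE x in \<mu>. psi_approximable \<psi> x) \<longleftrightarrow>
          (\<Sum>q. ennreal (real (Suc q) * \<psi> (Suc q))) = \<infinity>)"
    using \<nu> psi0_pos psi0_decseq psi0_sum by blast
qed

end
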